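(* Let $\mathcal{B}$ be a Banach space with dual $\mathcal{B}^\ast$. A Gaussian field $U$ with sample paths almost surely in $\mathcal{B}$ is characteristic over $\mathcal{B}^\ast$ if and only if $\mathcal{S}_{U,\mathcal{B}}=\mathcal{B}$. In that case, for every $f\in\mathcal{B}$ and every $\varepsilon>0$, $\mathrm{P}[\|U-f\|_{\mathcal{B}}<\varepsilon]>0$.
   Context: $U$ is a real Gaussian random field on a set $\mathcal{X}\subset\mathbb{R}^d$, defined on a probability space with probability $\mathrm{P}$; its sample paths may be generalized functions. For $f\in\mathcal{B}$ and $\eta\in\mathcal{B}^\ast$, $\langle f,\eta\rangle$ denotes the duality pairing; when $\eta=\mu-\nu$ is a difference of finite Borel measures on $\mathcal{X}$ of total mass zero, $\langle U,\mu-\nu\rangle=\int_{\mathcal{X}}U(x)\,(d\mu(x)-d\nu(x))$. For $\eta\in\mathcal{B}^\ast$ put $\mathcal{D}^2(\eta)=\mathbb{E}_U\{\langle U,\eta\rangle^2\}$. The field $U$ is called characteristic over $\mathcal{B}^\ast$ if, for $\eta\in\mathcal{B}^\ast$, $\mathcal{D}^2(\eta)=0$ only when $\eta=0$ (that is, only when $\mu=\nu$, if $\eta=\mu-\nu$). An element $f\in\mathcal{B}$ is in the support of $U$ if $\mathrm{P}[\|U-f\|_{\mathcal{B}}<\varepsilon]>0$ for every $\varepsilon>0$. The set of all such $f$ is denoted $\mathcal{S}_{U,\mathcal{B}}$.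
   Formalization: The Gaussian field is assumed centred (otherwise false: U=(g,1) in R² is characteristic but has support R×{1}), and U is taken as a strongly measurable random element of B (automatic if B is separable). *)

theory Defs
  imports "HOL-Probability.Probability"
begin

text \<open>
  The Banach space is a type \<open>'b::banach\<close>, its dual is \<open>'b \<Rightarrow>\<^sub>L real\<close>.  Sample paths of a field
  live in an arbitrary type \<open>'s\<close> (functions on a subset of Euclidean space, or generalized
  functions on it); \<open>emb :: 'b \<Rightarrow> 's\<close> is the inclusion of the Banach space among them, assumed
  injective wherever it is used.  A path \<open>U \<omega>\<close> belongs to the Banach space when it lies in
  \<open>range emb\<close>, and it is then read there as \<open>inv emb (U \<omega>)\<close>.  Outside \<open>range emb\<close> the latter is a
  fixed arbitrary element; this concerns a null set of \<open>\<omega>\<close> only.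
\<close>

definition path_in :: "('b \<Rightarrow> 's) \<Rightarrow> ('w \<Rightarrow> 's) \<Rightarrow> 'w \<Rightarrow> 'b" where
  "path_in emb U \<omega> = inv emb (U \<omega>)"

definition pairing ::
    "('b::banach \<Rightarrow> 's) \<Rightarrow> ('w \<Rightarrow> 's) \<Rightarrow> ('b \<Rightarrow>\<^sub>L real) \<Rightarrow> 'w \<Rightarrow> real" where
  "pairing emb U \<eta> \<omega> = blinfun_apply \<eta> (path_in emb U \<omega>)"

text \<open>
  Random elements of a possibly nonseparable Banach space are measurable in the strong (Bochner)
  sense: Borel measurable and almost surely in a separable closed set.  The second clause holds
  trivially in a separable space.
\<close>

definition strongly_measurable :: "'w measure \<Rightarrow> ('w \<Rightarrow> 'b::banach) \<Rightarrow> bool" where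
  "strongly_measurable M V \<longleftrightarrow>
     V \<in> borel_measurable M \<and> (\<exists>D. countable D \<and> (AE \<omega> in M. V \<omega> \<in> closure D))"

text \<open>Constants count as (degenerate) Gaussian variables.\<close>

definition gaussian_rv :: "'w measure \<Rightarrow> ('w \<Rightarrow> real) \<Rightarrow> bool" where
  "gaussian_rv M X \<longleftrightarrow>
     X \<in> borel_measurable M \<and>
     (\<exists>m. (AE \<omega> in M. X \<omega> = m) \<or> (\<exists>\<sigma>>0. distributed M lborel X (normal_density m \<sigma>)))"

definition gaussian_field_in ::
    "'w measure \<Rightarrow> ('b::banach \<Rightarrow> 's) \<Rightarrow> ('w \<Rightarrow> 's) \<Rightarrow> bool" where
  "gaussian_field_in M emb U \<longleftrightarrow>
     (AE \<omega> in M. U \<omega> \<in> range emb) \<and>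
     strongly_measurable M (path_in emb U) \<and>
     (\<forall>\<eta>. gaussian_rv M (pairing emb U \<eta>))"

definition zero_mean :: "'w measure \<Rightarrow> ('b::banach \<Rightarrow> 's) \<Rightarrow> ('w \<Rightarrow> 's) \<Rightarrow> bool" where
  "zero_mean M emb U \<longleftrightarrow> (\<forall>\<eta>. (\<integral>\<omega>. pairing emb U \<eta> \<omega> \<partial>M) = 0)"

definition D_sq ::
    "'w measure \<Rightarrow> ('b::banach \<Rightarrow> 's) \<Rightarrow> ('w \<Rightarrow> 's) \<Rightarrow> ('b \<Rightarrow>\<^sub>L real) \<Rightarrow> real" where
  "D_sq M emb U \<eta> = (\<integral>\<omega>. (pairing emb U \<eta> \<omega>)\<^sup>2 \<partial>M)"

definition characteristic :: "'w measure \<Rightarrow> ('b::banach \<Rightarrow> 's) \<Rightarrow> ('w \<Rightarrow> 's) \<Rightarrow> bool" where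
  "characteristic M emb U \<longleftrightarrow> (\<forall>\<eta>. D_sq M emb U \<eta> = 0 \<longrightarrow> \<eta> = 0)"

definition ball_prob ::
    "'w measure \<Rightarrow> ('b::banach \<Rightarrow> 's) \<Rightarrow> ('w \<Rightarrow> 's) \<Rightarrow> 'b \<Rightarrow> real \<Rightarrow> real" where
  "ball_prob M emb U f \<epsilon> = measure M {\<omega> \<in> space M. norm (path_in emb U \<omega> - f) < \<epsilon>}"

definition field_support :: "'w measure \<Rightarrow> ('b::banach \<Rightarrow> 's) \<Rightarrow> ('w \<Rightarrow> 's) \<Rightarrow> 'b set" where
  "field_support M emb U = {f. \<forall>\<epsilon>>0. ball_prob M emb U f \<epsilon> > 0}"

end

theory Submission
  imports Defs
begin

text \<open>
  The statement concerns the law \<open>\<mu>\<close> of the field on the Banach space, and its core is that the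
  topological support of a centered Gaussian \<open>\<mu>\<close> is a closed linear subspace.  Granted this, if
  the support is not the whole space, then the Hahn--Banach theorem gives a functional
  \<open>\<eta> \<noteq> 0\<close> vanishing on it; since \<open>\<mu>\<close> is carried by its support by separability,
  \<open>\<eta>\<close> is zero almost surely, so its variance is zero and the field is not characteristic.
  Conversely, a functional of zero variance vanishes almost surely, whereas a nonzero functional has
  no zero on some ball, which would therefore have probability zero.

  The support is a subspace because of two invariances: if \<open>V\<close> and \<open>V'\<close> are independent with law
  \<open>\<mu>\<close>, then \<open>-V\<close> and \<open>(V + V') / \<surd>2\<close> also have law \<open>\<mu>\<close> (\<open>law_uminus\<close>,
  \<open>support_normalized_sum\<close>).  So the support is symmetric and contains \<open>(x + y) / \<surd>2\<close> with \<open>x\<close> and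
  \<open>y\<close>; a nonempty closed set with these properties is a subspace (\<open>subspace_if_normalized_sums\<close>).

  For a real centered normal variable both invariances are classical.  They pass to the Banach space
  by a Cramer--Wold theorem (\<open>law_determined_by_marginals\<close>): the law of a strongly measurable random
  element is determined by the laws of its images under the continuous functionals.  To prove it, one
  takes a compact set that carries nearly all the mass (\<open>strongly_measurable_tight\<close>) and approximates
  a bounded continuous function on it by linear combinations of the functions \<open>cos (\<eta> x + b)\<close>
  (\<open>trig_polys_approximate\<close>), whose expectations depend on the one-dimensional marginals only.
\<close>

section \<open>Hahn--Banach separation from a closed subspace\<close>

text \<open>
  A linear functional below a given sublinear one is found as a minimal sublinear functional.  All
  functionals involved are defined on the whole space, so no extension of partially defined
  functionals occurs.
\<close>

definition sublinear :: "('a::real_vector \<Rightarrow> real) \<Rightarrow> bool" where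
  "sublinear q \<longleftrightarrow> (\<forall>x y. q (x + y) \<le> q x + q y) \<and> (\<forall>c x. 0 \<le> c \<longrightarrow> q (c *\<^sub>R x) = c * q x)"

text \<open>
  Homogeneity needs only one inequality, since the other one follows by scaling with \<open>1 / c\<close>.
\<close>

lemma sublinearI:
  assumes "\<And>x y. q (x + y) \<le> q x + q y" "q 0 = 0"
    and le: "\<And>c x. 0 < c \<Longrightarrow> q (c *\<^sub>R x) \<le> c * q x"
  shows "sublinear q"
  unfolding sublinear_def
proof (intro conjI allI impI)
  fix c :: real and x assume "0 \<le> c"
  show "q (c *\<^sub>R x) = c * q x"
  proof (cases "c = 0")
    case False
    with \<open>0 \<le> c\<close> have c: "0 < c" by simp
    have "q x \<le> (1 / c) * q (c *\<^sub>R x)"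
      using le[of "1 / c" "c *\<^sub>R x"] c by simp
    with c have "c * q x \<le> q (c *\<^sub>R x)" by (simp add: field_simps)
    with le[OF c, of x] show ?thesis by simp
  qed (simp add: assms)
qed (rule assms)

lemma sublinear_add: "sublinear q \<Longrightarrow> q (x + y) \<le> q x + q y"
  and sublinear_scale: "sublinear q \<Longrightarrow> 0 \<le> c \<Longrightarrow> q (c *\<^sub>R x) = c * q x"
  by (simp_all add: sublinear_def)

lemma sublinear_zero: "sublinear q \<Longrightarrow> q 0 = 0"
  using sublinear_scale[of q 0 0] by simp

lemma sublinear_neg_le: "sublinear q \<Longrightarrow> - q (- x) \<le> q x"
  using sublinear_add[of q x "- x"] sublinear_zero[of q] by simp

text \<open>
  The infimum over \<open>t \<ge> 0\<close> of \<open>q (z + t y) - t q y\<close> lowers \<open>q\<close> just enough that it becomes additive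
  along \<open>y\<close>.  It serves twice: to show that a minimal functional is odd, and to force equality
  at a prescribed point.
\<close>

lemma sublinear_lower:
  fixes q :: "'a::real_vector \<Rightarrow> real"
  assumes q: "sublinear q"
  obtains q' where "sublinear q'" "\<And>z. q' z \<le> q z" "q' (- y) \<le> - q y"
proof -
  define q' where "q' z = (INF t\<in>{0..}. q (z + t *\<^sub>R y) - t * q y)" for z
  have bdd: "bdd_below ((\<lambda>t. q (z + t *\<^sub>R y) - t * q y) ` {0..})" for z
  proof (rule bdd_belowI2)
    fix t :: real assume "t \<in> {0..}"
    then show "- q (- z) \<le> q (z + t *\<^sub>R y) - t * q y"
      using sublinear_add[OF q, of "z + t *\<^sub>R y" "- z"] sublinear_scale[OF q, of t y] by simp
  qed
  have le: "q' z \<le> q (z + t *\<^sub>R y) - t * q y" if "0 \<le> t" for z t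
    unfolding q'_def using that by (intro cINF_lower[OF bdd]) simp
  have ge: "b \<le> q' z" if "\<And>t. 0 \<le> t \<Longrightarrow> b \<le> q (z + t *\<^sub>R y) - t * q y" for b z
    unfolding q'_def using that by (intro cINF_greatest) auto
  have "sublinear q'"
  proof (rule sublinearI)
    fix z w
    have "q' (z + w) \<le> (q (z + s *\<^sub>R y) - s * q y) + (q (w + t *\<^sub>R y) - t * q y)"
      if "0 \<le> s" "0 \<le> t" for s t
      using le[of "s + t" "z + w"] that sublinear_add[OF q, of "z + s *\<^sub>R y" "w + t *\<^sub>R y"]
      by (simp add: algebra_simps)
    then have "q' (z + w) - (q (w + t *\<^sub>R y) - t * q y) \<le> q' z" if "0 \<le> t" for t
      using that by (intro ge) (simp add: diff_le_eq)
    then have "q' (z + w) - q' z \<le> q' w"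
      by (intro ge) (simp add: algebra_simps)
    then show "q' (z + w) \<le> q' z + q' w" by simp
  next
    have "q' 0 \<le> 0" using le[of 0 0] sublinear_zero[OF q] by simp
    moreover have "0 \<le> q' 0" by (rule ge) (simp add: sublinear_scale[OF q])
    ultimately show "q' 0 = 0" by simp
  next
    fix c :: real and z assume c: "0 < c"
    have "q' (c *\<^sub>R z) / c \<le> q' z"
    proof (rule ge)
      fix t :: real assume "0 \<le> t"
      then have "q' (c *\<^sub>R z) \<le> q (c *\<^sub>R (z + t *\<^sub>R y)) - c * t * q y"
        using le[of "c * t" "c *\<^sub>R z"] c by (simp add: algebra_simps)
      also have "\<dots> = c * (q (z + t *\<^sub>R y) - t * q y)"
        using c sublinear_scale[OF q, of c "z + t *\<^sub>R y"] by (simp add: algebra_simps)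
      finally show "q' (c *\<^sub>R z) / c \<le> q (z + t *\<^sub>R y) - t * q y"
        using c by (simp add: field_simps)
    qed
    with c show "q' (c *\<^sub>R z) \<le> c * q' z" by (simp add: field_simps)
  qed
  moreover have "q' z \<le> q z" for z using le[of 0 z] by simp
  moreover have "q' (- y) \<le> - q y" using le[of 1 "- y"] sublinear_zero[OF q] by simp
  ultimately show thesis by (rule that)
qed

text \<open>
  A minimal functional is not lowered in any direction \<open>y\<close>, hence it is odd, and an odd sublinear
  functional is also superadditive.
\<close>

lemma minimal_sublinear_is_linear:
  fixes q :: "'a::real_vector \<Rightarrow> real"
  assumes q: "sublinear q" and min: "\<And>q'. sublinear q' \<Longrightarrow> (\<And>z. q' z \<le> q z) \<Longrightarrow> q' = q"
  shows "linear q"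
proof -
  have neg: "q (- y) = - q y" for y
  proof -
    obtain q' where q': "sublinear q'" "\<And>z. q' z \<le> q z" "q' (- y) \<le> - q y"
      using sublinear_lower[OF q, of y] by metis
    with min[OF q'(1,2)] sublinear_neg_le[OF q, of "- y"] show ?thesis by simp
  qed
  show ?thesis
  proof (rule linearI)
    fix x y
    have "q (- x + - y) \<le> q (- x) + q (- y)" by (rule sublinear_add[OF q])
    then have "q x + q y \<le> q (x + y)" using neg[of "x + y"] by (simp add: neg add.commute)
    with sublinear_add[OF q, of x y] show "q (x + y) = q x + q y" by simp
  next
    fix c :: real and x
    show "q (c *\<^sub>R x) = c *\<^sub>R q x"
    proof (cases "0 \<le> c")
      case False
      then show ?thesis
        using sublinear_scale[OF q, of "- c" x] neg[of "c *\<^sub>R x"] by simp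
    qed (simp add: sublinear_scale[OF q])
  qed
qed

text \<open>
  Zorn's lemma for the reversed pointwise order.  The pointwise infimum of a chain is finite because
  \<open>- p (- z)\<close> bounds every member from below, and it is subadditive because of any two members of the
  chain one is the smaller everywhere.
\<close>

lemma sublinear_minimal_below:
  fixes p :: "'a::real_vector \<Rightarrow> real"
  assumes p: "sublinear p"
  obtains q where "sublinear q" "\<And>z. q z \<le> p z"
    "\<And>q'. sublinear q' \<Longrightarrow> (\<And>z. q' z \<le> q z) \<Longrightarrow> q' = q"
proof -
  define A where "A = {q. sublinear q \<and> (\<forall>z. q z \<le> p z)}"
  define P :: "('a \<Rightarrow> real) \<Rightarrow> ('a \<Rightarrow> real) \<Rightarrow> bool" where "P q r \<longleftrightarrow> (\<forall>z. r z \<le> q z)" for q r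
  have "\<exists>m\<in>A. \<forall>a\<in>A. P m a \<longrightarrow> a = m"
  proof (rule predicate_Zorn)
    show "partial_order_on A (relation_of P A)"
      unfolding partial_order_on_def preorder_on_def refl_on_def trans_def antisym_def
        relation_of_def P_def
      by (auto intro: order_trans simp: fun_eq_iff order_antisym)
  next
    fix C assume C: "C \<in> Chains (relation_of P A)"
    then have CA: "C \<subseteq> A" and chain: "\<And>q r. q \<in> C \<Longrightarrow> r \<in> C \<Longrightarrow> P q r \<or> P r q"
      by (auto simp: Chains_def relation_of_def)
    show "\<exists>u\<in>A. \<forall>a\<in>C. P a u"
    proof (cases "C = {}")
      case True
      with p show ?thesis by (auto simp: A_def)
    next
      case False
      define u where "u z = (INF q\<in>C. q z)" for z
      have sub: "sublinear q" "q z \<le> p z" if "q \<in> C" for q z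
        using CA that by (auto simp: A_def)
      have bdd: "bdd_below ((\<lambda>q. q z) ` C)" for z
      proof (rule bdd_belowI2)
        fix q assume "q \<in> C"
        then show "- p (- z) \<le> q z"
          using sublinear_neg_le[OF sub(1), of q z] sub(2)[of q "- z"] by simp
      qed
      have le: "u z \<le> q z" if "q \<in> C" for q z
        unfolding u_def by (rule cINF_lower[OF bdd that])
      have ge: "b \<le> u z" if "\<And>q. q \<in> C \<Longrightarrow> b \<le> q z" for b z
        unfolding u_def using that False by (intro cINF_greatest)
      have "sublinear u"
      proof (rule sublinearI)
        fix z w
        have "u (z + w) \<le> q z + r w" if qr: "q \<in> C" "r \<in> C" for q r
          using chain[OF qr]
        proof
          assume "P q r"
          then have "r z \<le> q z" by (simp add: P_def)
          with le[OF qr(2), of "z + w"] sublinear_add[OF sub(1)[OF qr(2)], of z w]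
          show ?thesis by simp
        next
          assume "P r q"
          then have "q w \<le> r w" by (simp add: P_def)
          with le[OF qr(1), of "z + w"] sublinear_add[OF sub(1)[OF qr(1)], of z w]
          show ?thesis by simp
        qed
        then have "u (z + w) - r w \<le> u z" if "r \<in> C" for r
          using that by (intro ge) (simp add: diff_le_eq)
        then have "u (z + w) - u z \<le> u w"
          by (intro ge) (simp add: algebra_simps)
        then show "u (z + w) \<le> u z + u w" by simp
      next
        obtain q where "q \<in> C" using False by auto
        then have "u 0 \<le> 0" using le[of q 0] sublinear_zero[OF sub(1), of q] by simp
        moreover have "0 \<le> u 0" by (rule ge) (simp add: sublinear_zero[OF sub(1)])
        ultimately show "u 0 = 0" by simp
      next
        fix c :: real and z assume c: "0 < c"
        have "u (c *\<^sub>R z) / c \<le> u z"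
        proof (rule ge)
          fix q assume q: "q \<in> C"
          then show "u (c *\<^sub>R z) / c \<le> q z"
            using le[OF q, of "c *\<^sub>R z"] sublinear_scale[OF sub(1)[OF q], of c z] c
            by (simp add: field_simps)
        qed
        with c show "u (c *\<^sub>R z) \<le> c * u z" by (simp add: field_simps)
      qed
      moreover have "u z \<le> p z" for z
      proof -
        obtain q where "q \<in> C" using False by auto
        then show ?thesis using le[of q z] sub(2)[of q z] by simp
      qed
      ultimately show ?thesis using le by (auto simp: A_def P_def)
    qed
  qed
  then obtain q where q: "q \<in> A" "\<And>a. a \<in> A \<Longrightarrow> P q a \<Longrightarrow> a = q" by blast
  show thesis
  proof (rule that)
    show "sublinear q" "q z \<le> p z" for z using q(1) by (auto simp: A_def)
    show "q' = q" if "sublinear q'" "\<And>z. q' z \<le> q z" for q'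
      using q(1) that by (intro q(2)) (auto simp: A_def P_def intro: order_trans)
  qed
qed

text \<open>
  Lowering \<open>p\<close> in the direction \<open>x\<close> first yields \<open>f (- x) \<le> - p x\<close> for every \<open>f\<close> below, which
  for a linear \<open>f\<close> is \<open>p x \<le> f x\<close>.
\<close>

lemma sublinear_supporting_functional:
  fixes p :: "'a::real_vector \<Rightarrow> real"
  assumes p: "sublinear p"
  obtains f where "linear f" "\<And>z. f z \<le> p z" "f x = p x"
proof -
  obtain p' where p': "sublinear p'" "\<And>z. p' z \<le> p z" "p' (- x) \<le> - p x"
    using sublinear_lower[OF p, of x] by metis
  obtain f where f: "sublinear f" "\<And>z. f z \<le> p' z"
    "\<And>q'. sublinear q' \<Longrightarrow> (\<And>z. q' z \<le> f z) \<Longrightarrow> q' = f"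
    using sublinear_minimal_below[OF p'(1)] by metis
  have lin: "linear f" using f(1,3) by (rule minimal_sublinear_is_linear)
  have fp: "f z \<le> p z" for z using f(2)[of z] p'(2)[of z] by simp
  have "- f x \<le> - p x"
    using f(2)[of "- x"] p'(3) linear_neg[OF lin, of x] by simp
  with fp[of x] have "f x = p x" by simp
  with lin fp show thesis by (rule that)
qed

lemma infdist_subspace_sublinear:
  fixes S :: "'a::real_normed_vector set"
  assumes S: "subspace S"
  shows "sublinear (\<lambda>x. infdist x S)"
proof (rule sublinearI)
  have ne: "S \<noteq> {}" using subspace_0[OF S] by auto
  have ge: "b \<le> infdist x S" if "\<And>s. s \<in> S \<Longrightarrow> b \<le> dist x s" for b x
    unfolding infdist_notempty[OF ne] using that ne by (intro cINF_greatest) auto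
  fix x y :: 'a
  have "infdist (x + y) S \<le> dist x s + dist y t" if st: "s \<in> S" "t \<in> S" for s t
    using infdist_le[OF subspace_add[OF S st], of "x + y"] dist_triangle_add[of x y s t] by simp
  then have "infdist (x + y) S - dist y t \<le> infdist x S" if "t \<in> S" for t
    using that by (intro ge) (simp add: diff_le_eq)
  then have "infdist (x + y) S - infdist x S \<le> infdist y S"
    by (intro ge) (simp add: algebra_simps)
  then show "infdist (x + y) S \<le> infdist x S + infdist y S" by simp
  show "infdist 0 S = 0" using subspace_0[OF S] by simp
  fix c :: real assume c: "0 < c"
  have "infdist (c *\<^sub>R x) S / c \<le> infdist x S"
  proof (rule ge)
    fix s assume "s \<in> S"
    then have "infdist (c *\<^sub>R x) S \<le> c * dist x s"
      using infdist_le[OF subspace_scale[OF S, of s c], of "c *\<^sub>R x"] c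
      by (simp add: dist_norm flip: scaleR_diff_right)
    with c show "infdist (c *\<^sub>R x) S / c \<le> dist x s" by (simp add: field_simps)
  qed
  with c show "infdist (c *\<^sub>R x) S \<le> c * infdist x S" by (simp add: field_simps)
qed

text \<open>
  The functional is dominated by the distance to \<open>S\<close>, hence bounded and zero on \<open>S\<close>, and it attains
  this distance at \<open>x\<close>.
\<close>

theorem separate_point_from_closed_subspace:
  fixes S :: "'a::real_normed_vector set"
  assumes S: "subspace S" "closed S" and x: "x \<notin> S"
  obtains \<eta> :: "'a \<Rightarrow>\<^sub>L real" where "\<And>s. s \<in> S \<Longrightarrow> \<eta> s = 0" "\<eta> x \<noteq> 0"
proof -
  have S0: "0 \<in> S" by (rule subspace_0[OF S(1)])
  obtain f where f: "linear f" "\<And>z. f z \<le> infdist z S" "f x = infdist x S"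
    using sublinear_supporting_functional[OF infdist_subspace_sublinear[OF S(1)], of x] by metis
  have abs: "\<bar>f z\<bar> \<le> infdist z S" for z
  proof -
    have "infdist (- z) S \<le> (INF s\<in>S. dist z s)"
    proof (rule cINF_greatest)
      show "infdist (- z) S \<le> dist z s" if "s \<in> S" for s
        using infdist_le[OF subspace_neg[OF S(1) that], of "- z"] by (simp add: dist_minus)
    qed (use S0 in auto)
    also have "\<dots> = infdist z S" using S0 by (subst infdist_notempty) auto
    finally have "infdist (- z) S \<le> infdist z S" .
    then show ?thesis
      using f(2)[of z] f(2)[of "- z"] linear_neg[OF f(1), of z] by (simp add: abs_le_iff)
  qed
  have "bounded_linear f"
  proof (rule bounded_linear_intro[where K = 1])
    show "norm (f z) \<le> norm z * 1" for z
      using abs[of z] infdist_le[OF S0, of z] by simp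
  qed (simp_all add: linear_add[OF f(1)] linear_scale[OF f(1)])
  then have ap: "blinfun_apply (Blinfun f) = f" by (rule bounded_linear_Blinfun_apply)
  show thesis
  proof (rule that)
    show "Blinfun f s = 0" if "s \<in> S" for s
      using abs[of s] that by (simp add: ap)
    show "Blinfun f x \<noteq> 0"
      using infdist_pos_not_in_closed[OF S(2) _ x] S0 f(3) unfolding ap by force
  qed
qed

section \<open>Tightness\<close>

text \<open>
  Ulam's argument.  For each \<open>n\<close>, finitely many balls of radius \<open>1 / (n + 1)\<close> around points of the
  countable set carry all but \<open>e / 2 ^ (n + 1)\<close> of the mass.  The intersection over \<open>n\<close> of these finite
  unions is closed and totally bounded.
\<close>

lemma strongly_measurable_tight:
  fixes V :: "'w \<Rightarrow> 'b::banach"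
  assumes M: "prob_space M" and V: "strongly_measurable M V" and e: "0 < e"
  obtains K where "compact K" "measure M {\<omega> \<in> space M. V \<omega> \<notin> K} \<le> e"
proof -
  interpret prob_space M by fact
  have Vm[measurable]: "V \<in> borel_measurable M" using V by (simp add: strongly_measurable_def)
  obtain D where D: "countable D" "AE \<omega> in M. V \<omega> \<in> closure D"
    using V by (auto simp: strongly_measurable_def)
  have "D \<noteq> {}" using D(2) by (auto simp: AE_False)
  define d where "d = from_nat_into D"
  define B where "B n k = (\<Union>i<k. cball (d i) (1 / real (Suc n)))" for n k :: nat
  have closed_B: "closed (B n k)" for n k unfolding B_def by (intro closed_UN) auto
  have meas[measurable]: "{\<omega> \<in> space M. V \<omega> \<notin> B n k} \<in> sets M" for n k
    using measurable_sets[OF Vm, of "- B n k"] closed_B[of n k]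
    by (simp add: vimage_def Int_def conj_commute open_Compl)
  have "\<exists>k. prob {\<omega> \<in> space M. V \<omega> \<notin> B n k} < e * (1 / 2) ^ Suc n" for n
  proof -
    have "decseq (\<lambda>k. {\<omega> \<in> space M. V \<omega> \<notin> B n k})"
      by (force simp: decseq_def B_def)
    then have "(\<lambda>k. prob {\<omega> \<in> space M. V \<omega> \<notin> B n k})
        \<longlonglongrightarrow> prob (\<Inter>k. {\<omega> \<in> space M. V \<omega> \<notin> B n k})"
      by (intro finite_Lim_measure_decseq) auto
    moreover have "prob (\<Inter>k. {\<omega> \<in> space M. V \<omega> \<notin> B n k}) = 0"
    proof -
      have "V \<omega> \<notin> closure D" if "\<omega> \<in> (\<Inter>k. {\<omega> \<in> space M. V \<omega> \<notin> B n k})" for \<omega>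
      proof
        assume "V \<omega> \<in> closure D"
        then obtain y where y: "y \<in> D" "dist y (V \<omega>) < 1 / real (Suc n)"
          unfolding closure_approachable by (meson of_nat_0_less_iff zero_less_Suc zero_less_divide_1_iff)
        obtain i where "d i = y"
          using from_nat_into_surj[OF D(1) y(1)] by (auto simp: d_def)
        with y(2) have "V \<omega> \<in> B n (Suc i)" by (auto simp: B_def intro!: bexI[of _ i] less_imp_le)
        with that show False by blast
      qed
      then have "AE \<omega> in M. \<omega> \<notin> (\<Inter>k. {\<omega> \<in> space M. V \<omega> \<notin> B n k})"
        by (intro eventually_mono[OF D(2)]) blast
      then show ?thesis by (subst prob_eq_0) measurable
    qed
    ultimately have "(\<lambda>k. prob {\<omega> \<in> space M. V \<omega> \<notin> B n k}) \<longlonglongrightarrow> 0" by simp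
    then have "\<forall>\<^sub>F k in sequentially. prob {\<omega> \<in> space M. V \<omega> \<notin> B n k} < e * (1 / 2) ^ Suc n"
      by (rule order_tendstoD) (use e in simp)
    then show ?thesis by (auto simp: eventually_sequentially)
  qed
  then obtain k where k: "\<And>n. prob {\<omega> \<in> space M. V \<omega> \<notin> B n (k n)} < e * (1 / 2) ^ Suc n" by metis
  define K where "K = (\<Inter>n. B n (k n))"
  show thesis
  proof (rule that[of K])
    show "compact K" unfolding compact_eq_totally_bounded
    proof (intro conjI allI impI)
      show "uniform_space_class.complete K" using closed_B by (auto simp: complete_eq_closed K_def)
      fix r :: real assume "0 < r"
      then obtain n where n: "1 / real (Suc n) < r" by (rule nat_approx_posE)
      have "K \<subseteq> (\<Union>x\<in>d ` {..<k n}. ball x r)"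
      proof
        fix x assume "x \<in> K"
        then have "x \<in> B n (k n)" by (auto simp: K_def)
        with n show "x \<in> (\<Union>x\<in>d ` {..<k n}. ball x r)" by (auto simp: B_def intro: order.strict_trans1)
      qed
      then show "\<exists>k. finite k \<and> K \<subseteq> (\<Union>x\<in>k. ball x r)" by blast
    qed
    have sums: "(\<lambda>n. e * (1 / 2) ^ Suc n) sums e"
      using sums_mult[OF power_half_series, of e] by simp
    have summ: "summable (\<lambda>n. prob {\<omega> \<in> space M. V \<omega> \<notin> B n (k n)})"
      by (rule summable_comparison_test'[OF sums_summable[OF sums], of 0])
         (simp only: real_norm_def abs_of_nonneg[OF measure_nonneg] less_imp_le[OF k])
    have "prob {\<omega> \<in> space M. V \<omega> \<notin> K} = prob (\<Union>n. {\<omega> \<in> space M. V \<omega> \<notin> B n (k n)})"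
      by (rule arg_cong[where f = prob]) (auto simp: K_def)
    also have "\<dots> \<le> (\<Sum>n. prob {\<omega> \<in> space M. V \<omega> \<notin> B n (k n)})"
      by (rule finite_measure_subadditive_countably) (use summ in auto)
    also have "\<dots> \<le> (\<Sum>n. e * (1 / 2) ^ Suc n)"
      using k by (intro suminf_le summ sums_summable[OF sums]) (auto intro: less_imp_le)
    also have "\<dots> = e" using sums by (simp add: sums_iff)
    finally show "prob {\<omega> \<in> space M. V \<omega> \<notin> K} \<le> e" .
  qed
qed

section \<open>The law of a random element is determined by its one-dimensional marginals\<close>

text \<open>
  The phase \<open>b\<close> makes sines, and with \<open>\<eta> = 0\<close> also constants, special cases.
\<close>

inductive_set trig_polys :: "('a::real_normed_vector \<Rightarrow> real) set" where
  cosine: "(\<lambda>x. a * cos (blinfun_apply \<eta> x + b)) \<in> trig_polys"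
| add: "f \<in> trig_polys \<Longrightarrow> g \<in> trig_polys \<Longrightarrow> (\<lambda>x. f x + g x) \<in> trig_polys"

lemma trig_polys_const: "(\<lambda>_. c) \<in> trig_polys"
  using trig_polys.cosine[of c 0 0] by simp

lemma trig_polys_mult:
  assumes "f \<in> trig_polys" "g \<in> trig_polys"
  shows "(\<lambda>x. f x * g x) \<in> trig_polys"
  using assms(1)
proof (induction rule: trig_polys.induct)
  case (cosine a \<eta> b)
  from assms(2) show ?case
  proof (induction rule: trig_polys.induct)
    case (cosine c \<zeta> d)
    have "(\<lambda>x. a * cos (\<eta> x + b) * (c * cos (\<zeta> x + d))) =
      (\<lambda>x. a * c / 2 * cos ((\<eta> - \<zeta>) x + (b - d)) + a * c / 2 * cos ((\<eta> + \<zeta>) x + (b + d)))"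
    proof
      fix x
      have "cos (\<eta> x + b) * cos (\<zeta> x + d) =
        (cos ((\<eta> - \<zeta>) x + (b - d)) + cos ((\<eta> + \<zeta>) x + (b + d))) / 2"
        using cos_times_cos[of "\<eta> x + b" "\<zeta> x + d"]
        by (simp add: blinfun.diff_left blinfun.add_left algebra_simps)
      moreover have "a * u * (c * v) = a * c / 2 * s + a * c / 2 * t" if "u * v = (s + t) / 2"
        for u v s t :: real
        using that by algebra
      ultimately show "a * cos (\<eta> x + b) * (c * cos (\<zeta> x + d)) =
        a * c / 2 * cos ((\<eta> - \<zeta>) x + (b - d)) + a * c / 2 * cos ((\<eta> + \<zeta>) x + (b + d))"
        by blast
    qed
    then show ?case by (simp only:) (intro trig_polys.intros)
  next
    case (add g1 g2)
    from trig_polys.add[OF add.IH] show ?case by (simp add: algebra_simps)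
  qed
next
  case (add f1 f2)
  from trig_polys.add[OF add.IH] show ?case by (simp add: algebra_simps)
qed

lemma trig_polys_continuous: "f \<in> trig_polys \<Longrightarrow> continuous_on A f"
  by (induction rule: trig_polys.induct) (intro continuous_intros; assumption)+

lemma trig_polys_bounded: "f \<in> trig_polys \<Longrightarrow> \<exists>C. \<forall>x. \<bar>f x\<bar> \<le> C"
proof (induction rule: trig_polys.induct)
  case (cosine a \<eta> b)
  show ?case by (rule exI[of _ "\<bar>a\<bar>"]) (simp add: abs_mult mult_left_le)
next
  case (add f g)
  then obtain C C' where "\<forall>x. \<bar>f x\<bar> \<le> C" "\<forall>x. \<bar>g x\<bar> \<le> C'" by blast
  then have "\<forall>x. \<bar>f x + g x\<bar> \<le> C + C'" by (meson abs_triangle_ineq add_mono order_trans)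
  then show ?case by blast
qed

text \<open>
  This allows a trigonometric polynomial to be truncated, up to a small error, without leaving the
  algebra.
\<close>

lemma trig_polys_compose_polynomial:
  assumes "real_polynomial_function q" "f \<in> trig_polys"
  shows "(\<lambda>x. q (f x)) \<in> trig_polys"
  using assms(1)
proof (induction rule: real_polynomial_function.induct)
  case (linear h)
  then obtain c where "h = (\<lambda>t. t * c)" by (auto simp: real_bounded_linear)
  with trig_polys_mult[OF assms(2) trig_polys_const] show ?case by simp
qed (auto intro: trig_polys_const trig_polys.add trig_polys_mult)

text \<open>
  A functional that separates \<open>x\<close> from \<open>y\<close> is rescaled so that its values differ by \<open>\<pi>\<close>; the cosine
  shifted to have phase \<open>0\<close> at \<open>y\<close> then takes the values \<open>-1\<close> and \<open>1\<close>.
\<close>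

lemma trig_polys_separate:
  fixes x y :: "'a::real_normed_vector"
  assumes "x \<noteq> y"
  shows "\<exists>f\<in>trig_polys. f x \<noteq> f y"
proof -
  obtain \<eta> :: "'a \<Rightarrow>\<^sub>L real" where \<eta>: "\<eta> (x - y) \<noteq> 0"
    using separate_point_from_closed_subspace[of "{0}" "x - y"] assms by (auto simp: subspace_single_0)
  define \<zeta> where "\<zeta> = (pi / \<eta> (x - y)) *\<^sub>R \<eta>"
  have "\<zeta> (x - y) = pi" using \<eta> by (simp add: \<zeta>_def blinfun.scaleR_left)
  then have "\<zeta> x + - \<zeta> y = pi" using blinfun.diff_right[of \<zeta> x y] by linarith
  \<comment> \<open>The factor \<open>1\<close> and the sum with \<open>- \<zeta> y\<close> give the cosines the shape of the generators of \<open>trig_polys\<close>.\<close>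
  then have "1 * cos (\<zeta> x + - \<zeta> y) = - 1" by (simp only: cos_pi mult_1)
  moreover have "1 * cos (\<zeta> y + - \<zeta> y) = 1" by (simp only: add.right_inverse cos_zero mult_1)
  ultimately have "1 * cos (\<zeta> x + - \<zeta> y) \<noteq> 1 * cos (\<zeta> y + - \<zeta> y)" by linarith
  then show ?thesis
    by (intro bexI[of _ "\<lambda>z. 1 * cos (\<zeta> z + - \<zeta> y)"] trig_polys.cosine)
qed

text \<open>
  The Stone--Weierstrass theorem controls the approximant on \<open>K\<close> only, while its expectation also
  depends on its size off \<open>K\<close>.  As the approximant is bounded on the whole space, its range lies in a
  compact interval, where truncation to \<open>[-1, 1]\<close> is uniformly close to a polynomial; composing
  with that polynomial gives a bound that holds everywhere and does not depend on \<open>K\<close>.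
\<close>

lemma trig_polys_approximate:
  fixes g :: "'a::real_normed_vector \<Rightarrow> real"
  assumes K: "compact K" and g: "continuous_on K g" "\<And>x. \<bar>g x\<bar> \<le> 1" and e: "0 < e"
  obtains p where "p \<in> trig_polys" "\<And>x. x \<in> K \<Longrightarrow> \<bar>g x - p x\<bar> \<le> e" "\<And>x. \<bar>p x\<bar> \<le> 1 + e"
proof -
  interpret function_ring_on trig_polys K
    using K by unfold_locales
      (auto intro: trig_polys_continuous trig_polys.add trig_polys_mult trig_polys_const trig_polys_separate)
  obtain f where f: "f \<in> trig_polys" "\<And>x. x \<in> K \<Longrightarrow> \<bar>g x - f x\<bar> < e / 2"
    using Stone_Weierstrass_basic[OF g(1), of "e / 2"] e by auto
  obtain C where C: "\<And>x. \<bar>f x\<bar> \<le> C" using trig_polys_bounded[OF f(1)] by auto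
  define clip :: "real \<Rightarrow> real" where "clip t = max (- 1) (min 1 t)" for t
  have clip: "\<bar>clip t\<bar> \<le> 1" "\<bar>clip s - clip t\<bar> \<le> \<bar>s - t\<bar>" "\<bar>s\<bar> \<le> 1 \<Longrightarrow> clip s = s" for s t
    by (auto simp: clip_def)
  have "continuous_on {-C..C} clip" unfolding clip_def by (intro continuous_intros)
  then obtain q where q: "real_polynomial_function q" "\<And>t. t \<in> {-C..C} \<Longrightarrow> \<bar>clip t - q t\<bar> < e / 2"
    using Stone_Weierstrass_real_polynomial_function[of "{-C..C}" clip "e / 2"] e by auto
  have qf: "\<bar>clip (f x) - q (f x)\<bar> < e / 2" for x
    by (rule q(2)) (use C[of x] in \<open>auto simp: abs_le_iff\<close>)
  show thesis
  proof (rule that)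
    show "(\<lambda>x. q (f x)) \<in> trig_polys" by (rule trig_polys_compose_polynomial[OF q(1) f(1)])
    show "\<bar>g x - q (f x)\<bar> \<le> e" if "x \<in> K" for x
      using qf[of x] f(2)[OF that] clip(2)[of "g x" "f x"] clip(3)[OF g(2)[of x]] by linarith
    show "\<bar>q (f x)\<bar> \<le> 1 + e" for x
      using qf[of x] clip(1)[of "f x"] e by linarith
  qed
qed

lemma trig_polys_expectation_eq:
  fixes V :: "'w \<Rightarrow> 'b::banach" and W :: "'v \<Rightarrow> 'b"
  assumes "prob_space M" "prob_space N"
    and V[measurable]: "V \<in> borel_measurable M" and W[measurable]: "W \<in> borel_measurable N"
    and marg: "\<And>\<eta>::'b \<Rightarrow>\<^sub>L real. distr M borel (\<lambda>\<omega>. \<eta> (V \<omega>)) = distr N borel (\<lambda>\<omega>. \<eta> (W \<omega>))"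
    and f: "f \<in> trig_polys"
  shows "integrable M (\<lambda>\<omega>. f (V \<omega>)) \<and> integrable N (\<lambda>\<omega>. f (W \<omega>)) \<and>
    (\<integral>\<omega>. f (V \<omega>) \<partial>M) = (\<integral>\<omega>. f (W \<omega>) \<partial>N)"
proof -
  interpret M: prob_space M by fact
  interpret N: prob_space N by fact
  have [measurable]: "blinfun_apply \<eta> \<in> borel_measurable borel" for \<eta> :: "'b \<Rightarrow>\<^sub>L real"
    by (intro borel_measurable_continuous_onI continuous_intros)
  show ?thesis using f
  proof (induction rule: trig_polys.induct)
    case (cosine a \<eta> b)
    have "(\<integral>\<omega>. a * cos (\<eta> (V \<omega>) + b) \<partial>M) = (\<integral>t. a * cos (t + b) \<partial>distr M borel (\<lambda>\<omega>. \<eta> (V \<omega>)))"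
      by (subst integral_distr) auto
    also have "\<dots> = (\<integral>\<omega>. a * cos (\<eta> (W \<omega>) + b) \<partial>N)"
      unfolding marg by (subst integral_distr) auto
    finally have "(\<integral>\<omega>. a * cos (\<eta> (V \<omega>) + b) \<partial>M) = (\<integral>\<omega>. a * cos (\<eta> (W \<omega>) + b) \<partial>N)" .
    moreover have "integrable M (\<lambda>\<omega>. a * cos (\<eta> (V \<omega>) + b))"
      by (intro integrable_mult_right M.integrable_const_bound[where B = 1]) auto
    moreover have "integrable N (\<lambda>\<omega>. a * cos (\<eta> (W \<omega>) + b))"
      by (intro integrable_mult_right N.integrable_const_bound[where B = 1]) auto
    ultimately show ?case by blast
  qed auto
qed

lemma prob_expectation_bound:
  fixes h :: "'b::banach \<Rightarrow> real"
  assumes "prob_space M" and [measurable]: "V \<in> borel_measurable M" "h \<in> borel_measurable borel"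
    and K: "closed K" "\<And>x. x \<in> K \<Longrightarrow> \<bar>h x\<bar> \<le> e" and h: "\<And>x. \<bar>h x\<bar> \<le> c" and "0 \<le> e" "0 \<le> c"
  shows "\<bar>\<integral>\<omega>. h (V \<omega>) \<partial>M\<bar> \<le> e + c * measure M {\<omega> \<in> space M. V \<omega> \<notin> K}"
proof -
  interpret prob_space M by fact
  define A where "A = {\<omega> \<in> space M. V \<omega> \<notin> K}"
  have A[measurable]: "A \<in> sets M"
    using measurable_sets[OF assms(2), of "- K"] K(1)
    by (simp add: A_def vimage_def Int_def conj_commute open_Compl)
  have int: "integrable M (\<lambda>\<omega>. h (V \<omega>))"
    by (rule integrable_const_bound[where B = c]) (auto simp: h)
  have intA: "integrable M (\<lambda>\<omega>. c * indicator A \<omega>)"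
    by (rule integrable_const_bound[where B = c]) (use \<open>0 \<le> c\<close> in \<open>auto simp: indicator_def\<close>)
  have "\<bar>\<integral>\<omega>. h (V \<omega>) \<partial>M\<bar> \<le> (\<integral>\<omega>. \<bar>h (V \<omega>)\<bar> \<partial>M)" by (rule integral_abs_bound)
  also have "\<dots> \<le> (\<integral>\<omega>. e + c * indicator A \<omega> \<partial>M)"
  proof (rule integral_mono)
    show "\<bar>h (V \<omega>)\<bar> \<le> e + c * indicator A \<omega>" if "\<omega> \<in> space M" for \<omega>
      using K(2)[of "V \<omega>"] h[of "V \<omega>"] that \<open>0 \<le> e\<close> by (auto simp: A_def indicator_def)
  qed (use int intA in simp_all)
  also have "\<dots> = (\<integral>\<omega>. e \<partial>M) + (\<integral>\<omega>. c * indicator A \<omega> \<partial>M)"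
    by (rule Bochner_Integration.integral_add[OF _ intA]) simp
  also have "\<dots> = e + c * prob A" using prob_space by simp
  finally show ?thesis by (simp add: A_def)
qed

text \<open>
  An infinite-dimensional version of the Cramer--Wold theorem.  Off a compact set of probability at
  least \<open>1 - e\<close> the error of the approximation is at most \<open>3\<close>, whatever the compact set, so the
  expectations of a continuous function with values in \<open>[-1, 1]\<close> agree up to a multiple of \<open>e\<close>.
  Indicators of open sets are increasing limits of such functions, and open sets generate the Borel
  sets.
\<close>

theorem law_determined_by_marginals:
  fixes V :: "'w \<Rightarrow> 'b::banach" and W :: "'v \<Rightarrow> 'b"
  assumes M: "prob_space M" and N: "prob_space N"
    and V: "strongly_measurable M V" and W: "strongly_measurable N W"
    and marg: "\<And>\<eta>::'b \<Rightarrow>\<^sub>L real. distr M borel (\<lambda>\<omega>. \<eta> (V \<omega>)) = distr N borel (\<lambda>\<omega>. \<eta> (W \<omega>))"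
  shows "distr M borel V = distr N borel W"
proof -
  interpret M: prob_space M by fact
  interpret N: prob_space N by fact
  have Vm[measurable]: "V \<in> borel_measurable M" using V by (simp add: strongly_measurable_def)
  have Wm[measurable]: "W \<in> borel_measurable N" using W by (simp add: strongly_measurable_def)
  interpret V: prob_space "distr M borel V" by (rule M.prob_space_distr) fact
  interpret W: prob_space "distr N borel W" by (rule N.prob_space_distr) fact
  have expect: "(\<integral>\<omega>. g (V \<omega>) \<partial>M) = (\<integral>\<omega>. g (W \<omega>) \<partial>N)"
    if g: "continuous_on UNIV g" "\<And>x. \<bar>g x\<bar> \<le> 1" for g :: "'b \<Rightarrow> real"
  proof -
    have gm[measurable]: "g \<in> borel_measurable borel" by (rule borel_measurable_continuous_onI[OF g(1)])
    \<comment> \<open>Each side differs from the expectation of the approximant by at most \<open>e + 3 e\<close>.\<close>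
    have bound: "\<bar>(\<integral>\<omega>. g (V \<omega>) \<partial>M) - (\<integral>\<omega>. g (W \<omega>) \<partial>N)\<bar> \<le> 8 * e" if e: "0 < e" "e \<le> 1" for e
    proof -
      obtain K1 where K1: "compact K1" "measure M {\<omega> \<in> space M. V \<omega> \<notin> K1} \<le> e"
        using strongly_measurable_tight[OF M V e(1)] by metis
      obtain K2 where K2: "compact K2" "measure N {\<omega> \<in> space N. W \<omega> \<notin> K2} \<le> e"
        using strongly_measurable_tight[OF N W e(1)] by metis
      obtain p where p: "p \<in> trig_polys" "\<And>x. x \<in> K1 \<union> K2 \<Longrightarrow> \<bar>g x - p x\<bar> \<le> e" "\<And>x. \<bar>p x\<bar> \<le> 1 + e"
        using trig_polys_approximate[of "K1 \<union> K2" g e] K1(1) K2(1) g e(1)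
          continuous_on_subset[OF g(1)] by (metis compact_Un subset_UNIV)
      have [measurable]: "p \<in> borel_measurable borel"
        by (rule borel_measurable_continuous_onI[OF trig_polys_continuous[OF p(1)]])
      have le3: "\<bar>g x - p x\<bar> \<le> 3" for x using g(2)[of x] p(3)[of x] e(2) by linarith
      have "\<bar>\<integral>\<omega>. g (V \<omega>) - p (V \<omega>) \<partial>M\<bar> \<le> e + 3 * measure M {\<omega> \<in> space M. V \<omega> \<notin> K1}"
        by (rule prob_expectation_bound[OF M, where h = "\<lambda>x. g x - p x"])
           (use K1(1) p(2) le3 e in \<open>auto simp: compact_imp_closed\<close>)
      with K1(2) have 1: "\<bar>\<integral>\<omega>. g (V \<omega>) - p (V \<omega>) \<partial>M\<bar> \<le> 4 * e" by simp
      have "\<bar>\<integral>\<omega>. g (W \<omega>) - p (W \<omega>) \<partial>N\<bar> \<le> e + 3 * measure N {\<omega> \<in> space N. W \<omega> \<notin> K2}"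
        by (rule prob_expectation_bound[OF N, where h = "\<lambda>x. g x - p x"])
           (use K2(1) p(2) le3 e in \<open>auto simp: compact_imp_closed\<close>)
      with K2(2) have 2: "\<bar>\<integral>\<omega>. g (W \<omega>) - p (W \<omega>) \<partial>N\<bar> \<le> 4 * e" by simp
      have ints: "integrable M (\<lambda>\<omega>. g (V \<omega>))" "integrable N (\<lambda>\<omega>. g (W \<omega>))"
        by (auto intro!: M.integrable_const_bound[where B = 1] N.integrable_const_bound[where B = 1] simp: g(2))
      have "integrable M (\<lambda>\<omega>. p (V \<omega>))" "integrable N (\<lambda>\<omega>. p (W \<omega>))"
        "(\<integral>\<omega>. p (V \<omega>) \<partial>M) = (\<integral>\<omega>. p (W \<omega>) \<partial>N)"
        using trig_polys_expectation_eq[OF M N Vm Wm marg p(1)] by auto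
      with 1 2 ints show ?thesis by simp
    qed
    show ?thesis
    proof (rule ccontr)
      assume neq: "(\<integral>\<omega>. g (V \<omega>) \<partial>M) \<noteq> (\<integral>\<omega>. g (W \<omega>) \<partial>N)"
      define r where "r = \<bar>(\<integral>\<omega>. g (V \<omega>) \<partial>M) - (\<integral>\<omega>. g (W \<omega>) \<partial>N)\<bar>"
      have "0 < r" using neq by (simp add: r_def)
      with bound[of "min 1 (r / 16)"] show False
        unfolding r_def[symmetric] by linarith
    qed
  qed
  have eq_open: "emeasure (distr M borel V) G = emeasure (distr N borel W) G" if G: "open G" for G
  proof (cases "G = UNIV")
    case True
    then show ?thesis using V.emeasure_space_1 W.emeasure_space_1 by simp
  next
    case False
    define g :: "nat \<Rightarrow> 'b \<Rightarrow> real" where "g n x = min 1 (real n * infdist x (- G))" for n x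
    have gc: "continuous_on UNIV (g n)" for n unfolding g_def by (intro continuous_intros)
    have gb: "\<bar>g n x\<bar> \<le> 1" for n x by (auto simp: g_def infdist_nonneg)
    have [measurable]: "g n \<in> borel_measurable borel" for n by (rule borel_measurable_continuous_onI[OF gc])
    have [measurable]: "G \<in> sets borel" using G by simp
    have lim: "(\<lambda>n. g n x) \<longlonglongrightarrow> indicator G x" for x
    proof (cases "x \<in> G")
      case True
      then have pos: "0 < infdist x (- G)"
        using G False by (intro infdist_pos_not_in_closed) auto
      then obtain n where n: "1 < real n * infdist x (- G)" using reals_Archimedean3 by blast
      have "g m x = 1" if "n \<le> m" for m
      proof -
        have "real n * infdist x (- G) \<le> real m * infdist x (- G)"
          using that pos by (intro mult_right_mono) auto
        with n show ?thesis by (simp add: g_def)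
      qed
      then show ?thesis using True by (intro tendsto_eventually) (auto simp: eventually_sequentially)
    next
      case False
      then show ?thesis by (simp add: g_def)
    qed
    have "(\<lambda>n. \<integral>\<omega>. g n (V \<omega>) \<partial>M) \<longlonglongrightarrow> (\<integral>\<omega>. indicator G (V \<omega>) \<partial>M)"
      by (rule integral_dominated_convergence[where w = "\<lambda>_. 1"]) (use gb lim in auto)
    moreover have "(\<lambda>n. \<integral>\<omega>. g n (W \<omega>) \<partial>N) \<longlonglongrightarrow> (\<integral>\<omega>. indicator G (W \<omega>) \<partial>N)"
      by (rule integral_dominated_convergence[where w = "\<lambda>_. 1"]) (use gb lim in auto)
    ultimately have "(\<integral>\<omega>. indicator G (V \<omega>) \<partial>M) = (\<integral>\<omega>. indicator G (W \<omega>) \<partial>N :: real)"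
      using LIMSEQ_unique unfolding expect[OF gc gb] by blast
    then have "(\<integral>x. indicator G x \<partial>distr M borel V) = (\<integral>x. indicator G x \<partial>distr N borel W :: real)"
      by (subst (1 2) integral_distr) auto
    then show ?thesis by (simp add: V.emeasure_eq_measure W.emeasure_eq_measure)
  qed
  show ?thesis
  proof (rule measure_eqI_generator_eq[where E = "{G. open G}" and \<Omega> = UNIV and A = "\<lambda>_. UNIV"])
    show "Int_stable {G::'b set. open G}" by (auto simp: Int_stable_def)
    show "emeasure (distr M borel V) UNIV \<noteq> \<infinity>" by simp
  qed (auto simp: eq_open sets_borel)
qed

section \<open>Centered normal laws on the line\<close>

definition centered_normal :: "real measure \<Rightarrow> bool" where
  "centered_normal \<nu> \<longleftrightarrow>
    \<nu> = return borel 0 \<or> (\<exists>\<sigma>>0. distributed \<nu> lborel (\<lambda>t. t) (normal_density 0 \<sigma>))"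

lemma distributed_law_iff:
  assumes [measurable]: "X \<in> borel_measurable M"
  shows "distributed (distr M borel X) lborel (\<lambda>t. t) f \<longleftrightarrow> distributed M lborel X f"
  unfolding distributed_def by (simp add: distr_distr o_def)

lemma centered_normal_law:
  assumes M: "prob_space M" and X: "gaussian_rv M X" and mean: "(\<integral>\<omega>. X \<omega> \<partial>M) = 0"
  shows "centered_normal (distr M borel X)"
proof -
  interpret prob_space M by fact
  have [measurable]: "X \<in> borel_measurable M" using X by (simp add: gaussian_rv_def)
  from X consider m where "AE \<omega> in M. X \<omega> = m"
    | m \<sigma> where "0 < \<sigma>" "distributed M lborel X (normal_density m \<sigma>)"
    by (auto simp: gaussian_rv_def)
  then show ?thesis
  proof cases
    case 1
    then have "(\<integral>\<omega>. X \<omega> \<partial>M) = (\<integral>\<omega>. m \<partial>M)" by (intro integral_cong_AE) auto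
    with mean have "m = 0" using prob_space by simp
    with 1 have "distr M borel X = distr M borel (\<lambda>_. 0)" by (intro distr_cong_AE) auto
    also have "\<dots> = return borel 0" by (rule distr_const) simp
    finally show ?thesis by (simp add: centered_normal_def)
  next
    case 2
    with mean have "m = 0" using normal_distributed_expectation[of \<sigma> X m] by simp
    with 2 show ?thesis unfolding centered_normal_def by (auto simp: distributed_law_iff)
  qed
qed

lemma centered_normal_minus:
  assumes \<nu>: "centered_normal \<nu>" "prob_space \<nu>" and sets[measurable_cong]: "sets \<nu> = sets borel"
  shows "distr \<nu> borel uminus = \<nu>"
proof -
  interpret prob_space \<nu> by fact
  from \<nu>(1) consider "\<nu> = return borel 0"
    | \<sigma> where "0 < \<sigma>" "distributed \<nu> lborel (\<lambda>t. t) (normal_density 0 \<sigma>)"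
    by (auto simp: centered_normal_def)
  then show ?thesis
  proof cases
    case 1
    then show ?thesis by (simp add: distr_return)
  next
    case 2
    have "distributed \<nu> lborel uminus (normal_density 0 \<sigma>)"
      using normal_density_affine[OF 2(2,1), of "- 1" 0] by simp
    then have "distr \<nu> lborel uminus = distr \<nu> lborel (\<lambda>t. t)"
      using 2(2) by (simp add: distributed_def)
    moreover have "distr \<nu> borel uminus = distr \<nu> lborel uminus"
      by (rule distr_cong) simp_all
    moreover have "distr \<nu> lborel (\<lambda>t. t) = \<nu>"
      by (rule distr_id2) (simp add: sets)
    ultimately show ?thesis by simp
  qed
qed

lemma distr_pair_snd:
  assumes "prob_space M" "prob_space N"
  shows "distr (M \<Otimes>\<^sub>M N) N snd = N"
proof (rule measure_eqI)
  interpret M: prob_space M by fact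
  interpret N: prob_space N by fact
  fix A assume "A \<in> sets (distr (M \<Otimes>\<^sub>M N) N snd)"
  then have A: "A \<in> sets N" by simp
  have "snd -` A \<inter> space (M \<Otimes>\<^sub>M N) = space M \<times> A"
    using sets.sets_into_space[OF A] by (fastforce simp: space_pair_measure)
  then show "emeasure (distr (M \<Otimes>\<^sub>M N) N snd) A = emeasure N A"
    using A by (simp add: emeasure_distr N.emeasure_pair_measure_Times M.emeasure_space_1)
qed simp

lemma indep_var_pair_measure:
  assumes "prob_space M" "prob_space N"
  shows "prob_space.indep_var (M \<Otimes>\<^sub>M N) M fst N snd"
proof -
  interpret M: prob_space M by fact
  interpret N: prob_space N by fact
  interpret P: pair_prob_space M N ..
  show ?thesis
    unfolding P.indep_var_distribution_eq
    by (simp add: N.distr_pair_fst distr_pair_snd[OF assms] distr_id2)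
qed

text \<open>
  The variances of two independent copies add up, and the factor \<open>1 / \<surd>2\<close> restores the original one.
\<close>

lemma centered_normal_stable:
  assumes \<nu>: "centered_normal \<nu>" "prob_space \<nu>" and sets[measurable_cong]: "sets \<nu> = sets borel"
  shows "distr (\<nu> \<Otimes>\<^sub>M \<nu>) borel (\<lambda>z. (fst z + snd z) / sqrt 2) = \<nu>"
proof -
  interpret prob_space \<nu> by fact
  interpret P: pair_prob_space \<nu> \<nu> ..
  from \<nu>(1) consider "\<nu> = return borel 0"
    | \<sigma> where "0 < \<sigma>" "distributed \<nu> lborel (\<lambda>t. t) (normal_density 0 \<sigma>)"
    by (auto simp: centered_normal_def)
  then show ?thesis
  proof cases
    case 1
    have zero: "AE t in \<nu>. t = 0" unfolding 1 by (subst AE_return) auto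
    have "AE z in \<nu> \<Otimes>\<^sub>M \<nu>. (fst z + snd z) / sqrt 2 = 0"
    proof (rule P.AE_pair_measure)
      show "AE s in \<nu>. AE t in \<nu>. (fst (s, t) + snd (s, t)) / sqrt 2 = 0"
        using zero by (rule eventually_mono) (use zero in \<open>auto elim: eventually_mono\<close>)
    qed measurable
    then have "distr (\<nu> \<Otimes>\<^sub>M \<nu>) borel (\<lambda>z. (fst z + snd z) / sqrt 2) = distr (\<nu> \<Otimes>\<^sub>M \<nu>) borel (\<lambda>_. 0)"
      by (intro distr_cong_AE) auto
    also have "\<dots> = \<nu>" unfolding 1 by (rule P.distr_const[unfolded 1]) simp
    finally show ?thesis .
  next
    case 2
    have ind: "P.indep_var \<nu> fst \<nu> snd" by (rule indep_var_pair_measure) fact+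
    have "P.indep_var borel (\<lambda>z. fst z) borel (\<lambda>z. snd z)"
      using P.indep_var_compose[OF ind, of "\<lambda>t. t" borel "\<lambda>t. t" borel] sets
      by (simp add: o_def measurable_ident_sets)
    moreover have "distributed (\<nu> \<Otimes>\<^sub>M \<nu>) lborel fst (normal_density 0 \<sigma>)"
      "distributed (\<nu> \<Otimes>\<^sub>M \<nu>) lborel snd (normal_density 0 \<sigma>)"
    proof -
      have "distr (\<nu> \<Otimes>\<^sub>M \<nu>) borel fst = distr (\<nu> \<Otimes>\<^sub>M \<nu>) \<nu> fst"
        "distr (\<nu> \<Otimes>\<^sub>M \<nu>) borel snd = distr (\<nu> \<Otimes>\<^sub>M \<nu>) \<nu> snd"
        by (rule distr_cong; simp add: sets)+
      then have "distr (\<nu> \<Otimes>\<^sub>M \<nu>) borel fst = \<nu>" "distr (\<nu> \<Otimes>\<^sub>M \<nu>) borel snd = \<nu>"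
        by (simp_all only: distr_pair_fst distr_pair_snd[OF \<nu>(2) \<nu>(2)])
      then show "distributed (\<nu> \<Otimes>\<^sub>M \<nu>) lborel fst (normal_density 0 \<sigma>)"
        "distributed (\<nu> \<Otimes>\<^sub>M \<nu>) lborel snd (normal_density 0 \<sigma>)"
        using 2(2) distributed_law_iff[of fst "\<nu> \<Otimes>\<^sub>M \<nu>"] distributed_law_iff[of snd "\<nu> \<Otimes>\<^sub>M \<nu>"]
        by simp_all
    qed
    ultimately have "distributed (\<nu> \<Otimes>\<^sub>M \<nu>) lborel (\<lambda>z. fst z + snd z) (normal_density 0 (sqrt (\<sigma>\<^sup>2 + \<sigma>\<^sup>2)))"
      using P.add_indep_normal[of fst snd \<sigma> \<sigma> 0 0] 2(1) by simp
    moreover have "sqrt (\<sigma>\<^sup>2 + \<sigma>\<^sup>2) = sqrt 2 * \<sigma>" using 2(1) by (simp add: real_sqrt_mult flip: mult_2)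
    ultimately have "distributed (\<nu> \<Otimes>\<^sub>M \<nu>) lborel (\<lambda>z. (fst z + snd z) / sqrt 2) (normal_density 0 \<sigma>)"
      using P.normal_density_affine[of "\<lambda>z. fst z + snd z" 0 "sqrt 2 * \<sigma>" "1 / sqrt 2" 0] 2(1) by simp
    then have "distr (\<nu> \<Otimes>\<^sub>M \<nu>) lborel (\<lambda>z. (fst z + snd z) / sqrt 2) = distr \<nu> lborel (\<lambda>t. t)"
      using 2(2) by (simp add: distributed_def)
    moreover have "distr (\<nu> \<Otimes>\<^sub>M \<nu>) borel (\<lambda>z. (fst z + snd z) / sqrt 2) =
        distr (\<nu> \<Otimes>\<^sub>M \<nu>) lborel (\<lambda>z. (fst z + snd z) / sqrt 2)"
      by (rule distr_cong) simp_all
    moreover have "distr \<nu> lborel (\<lambda>t. t) = \<nu>"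
      by (rule distr_id2) (simp add: sets)
    ultimately show ?thesis by simp
  qed
qed

section \<open>Support of a Borel measure\<close>

text \<open>
  On a nonseparable space the Borel sets of the product may exceed the product \<open>\<sigma>\<close>-algebra, so sums
  of measurable functions need not be measurable.  If both summands stay in the closure of a countable
  set, then the preimage of an open set is a countable union of rectangles around points of that set.
\<close>

lemma borel_measurable_add_separable:
  fixes A B :: "'w \<Rightarrow> 'b::real_normed_vector"
  assumes D: "countable D" and A: "\<And>\<omega>. A \<omega> \<in> closure D" and B: "\<And>\<omega>. B \<omega> \<in> closure D"
    and "A \<in> borel_measurable M" "B \<in> borel_measurable M"
  shows "(\<lambda>\<omega>. A \<omega> + B \<omega>) \<in> borel_measurable M"
proof (rule borel_measurableI)
  fix G :: "'b set" assume G: "open G"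
  define I where "I = {(a, b, n :: nat). a \<in> D \<and> b \<in> D \<and>
    (\<forall>u v. dist a u < 1 / Suc n \<longrightarrow> dist b v < 1 / Suc n \<longrightarrow> u + v \<in> G)}"
  have "I \<subseteq> D \<times> D \<times> UNIV" by (auto simp: I_def)
  then have "countable I" by (rule countable_subset) (use D in auto)
  define C where "C a b n =
    (A -` ball a (1 / Suc n) \<inter> space M) \<inter> (B -` ball b (1 / Suc n) \<inter> space M)" for a b and n :: nat
  have C: "C a b n \<in> sets M" for a b n
    unfolding C_def by (intro sets.Int measurable_sets[OF assms(4)] measurable_sets[OF assms(5)]) simp_all
  have eq: "(\<lambda>\<omega>. A \<omega> + B \<omega>) -` G \<inter> space M = (\<Union>(a, b, n)\<in>I. C a b n)"
    (is "?L = ?R")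
  proof (intro equalityI subsetI)
    fix \<omega> assume \<omega>: "\<omega> \<in> ?L"
    then obtain e where e: "0 < e" "\<And>y. dist y (A \<omega> + B \<omega>) < e \<Longrightarrow> y \<in> G"
      using G by (auto simp: open_dist)
    obtain n where n: "1 / real (Suc n) < e / 4" using nat_approx_posE[of "e / 4"] e(1) by auto
    obtain a where a: "a \<in> D" "dist a (A \<omega>) < 1 / Suc n"
      using A[of \<omega>] unfolding closure_approachable by (meson of_nat_0_less_iff zero_less_Suc zero_less_divide_1_iff)
    obtain b where b: "b \<in> D" "dist b (B \<omega>) < 1 / Suc n"
      using B[of \<omega>] unfolding closure_approachable by (meson of_nat_0_less_iff zero_less_Suc zero_less_divide_1_iff)
    have "u + v \<in> G" if "dist a u < 1 / Suc n" "dist b v < 1 / Suc n" for u v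
    proof (rule e(2))
      have "dist (u + v) (A \<omega> + B \<omega>) \<le> dist u (A \<omega>) + dist v (B \<omega>)" by (rule dist_triangle_add)
      moreover have "dist u (A \<omega>) < e / 2" "dist v (B \<omega>) < e / 2"
        using dist_triangle3[of u "A \<omega>" a] dist_triangle3[of v "B \<omega>" b] that a(2) b(2) n by linarith+
      ultimately show "dist (u + v) (A \<omega> + B \<omega>) < e" by linarith
    qed
    with a(1) b(1) have "(a, b, n) \<in> I" by (auto simp: I_def)
    with \<omega> a(2) b(2) show "\<omega> \<in> ?R" by (fastforce simp: C_def)
  qed (auto simp: I_def C_def)
  show "(\<lambda>\<omega>. A \<omega> + B \<omega>) -` G \<inter> space M \<in> sets M"
    unfolding eq using \<open>countable I\<close> by (intro sets.countable_UN') (auto intro: C)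
qed

definition support :: "'b::metric_space measure \<Rightarrow> 'b set" where
  "support \<mu> = {x. \<forall>r>0. 0 < measure \<mu> (ball x r)}"

lemma closed_support:
  assumes "prob_space \<mu>" and sets[measurable_cong]: "sets \<mu> = sets borel"
  shows "closed (support \<mu>)"
proof -
  interpret prob_space \<mu> by fact
  have "x \<in> support \<mu>" if x: "x \<in> closure (support \<mu>)" for x
    unfolding support_def
  proof (intro CollectI allI impI)
    fix r :: real assume "0 < r"
    then obtain y where y: "y \<in> support \<mu>" "dist y x < r / 2"
      using x by (meson closure_approachable half_gt_zero)
    have "ball y (r / 2) \<subseteq> ball x r"
    proof
      fix z assume "z \<in> ball y (r / 2)"
      with y(2) dist_triangle3[of x z y] show "z \<in> ball x r" by (simp add: dist_commute)
    qed
    then have "prob (ball y (r / 2)) \<le> prob (ball x r)" by (intro finite_measure_mono) auto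
    moreover have "0 < prob (ball y (r / 2))" using y(1) \<open>0 < r\<close> by (auto simp: support_def)
    ultimately show "0 < prob (ball x r)" by simp
  qed
  then show ?thesis using closure_subset_eq by blast
qed

text \<open>
  A point outside the support that lies in the closure of the countable set \<open>D\<close> belongs to a null
  ball with centre in \<open>D\<close> and radius \<open>1 / (n + 1)\<close>.  There are only countably many of these.
\<close>

lemma AE_support:
  fixes \<mu> :: "'b::banach measure"
  assumes "prob_space \<mu>" and sets[measurable_cong]: "sets \<mu> = sets borel"
    and sep: "strongly_measurable \<mu> (\<lambda>x. x)"
  shows "AE x in \<mu>. x \<in> support \<mu>"
proof -
  interpret prob_space \<mu> by fact
  obtain D where D: "countable D" "AE x in \<mu>. x \<in> closure D"
    using sep by (auto simp: strongly_measurable_def)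
  define I where "I = {(d, n). d \<in> D \<and> prob (ball d (1 / real (Suc n))) = 0}"
  have "I \<subseteq> D \<times> UNIV" by (auto simp: I_def)
  then have "countable I" by (rule countable_subset) (use D(1) in auto)
  then have "AE x in \<mu>. \<forall>i\<in>I. x \<notin> ball (fst i) (1 / real (Suc (snd i)))"
    by (subst AE_ball_countable) (auto simp: I_def prob_eq_0)
  with D(2) show ?thesis
  proof eventually_elim
    case (elim x)
    show ?case
    proof (rule ccontr)
      assume "x \<notin> support \<mu>"
      then obtain r where r: "0 < r" "prob (ball x r) = 0"
        by (auto simp: support_def not_less measure_le_0_iff)
      obtain n where n: "1 / real (Suc n) < r / 2" using nat_approx_posE[of "r / 2"] r(1) by auto
      obtain d where d: "d \<in> D" "dist d x < 1 / Suc n"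
        using elim(1) unfolding closure_approachable
        by (meson of_nat_0_less_iff zero_less_Suc zero_less_divide_1_iff)
      have "ball d (1 / Suc n) \<subseteq> ball x r"
      proof
        fix z assume "z \<in> ball d (1 / Suc n)"
        with d(2) n dist_triangle3[of x z d] show "z \<in> ball x r" by (simp add: dist_commute)
      qed
      then have "prob (ball d (1 / Suc n)) \<le> prob (ball x r)" by (intro finite_measure_mono) auto
      with r(2) have "prob (ball d (1 / Suc n)) = 0" by (simp add: measure_le_0_iff)
      with d(1) have "(d, n) \<in> I" by (simp add: I_def)
      with elim(2) d(2) show False by (auto simp: dist_commute)
    qed
  qed
qed

text \<open>
  Taking \<open>y = - x\<close>, \<open>y = x\<close> and \<open>y = 0\<close> gives \<open>0\<close>, closure under multiplication by \<open>\<surd>2\<close>, and closure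
  under multiplication by \<open>1 / \<surd>2\<close>.  Hence the set is closed under addition and halving, so
  under dyadic multiples, and by topological closedness under real multiples.
\<close>

lemma subspace_if_normalized_sums:
  fixes S :: "'a::real_normed_vector set"
  assumes S: "closed S" "S \<noteq> {}" and neg: "\<And>x. x \<in> S \<Longrightarrow> - x \<in> S"
    and avg: "\<And>x y. x \<in> S \<Longrightarrow> y \<in> S \<Longrightarrow> (1 / sqrt 2) *\<^sub>R (x + y) \<in> S"
  shows "subspace S"
proof -
  obtain x where "x \<in> S" using S(2) by auto
  then have zero: "0 \<in> S" using avg[OF _ neg, of x x] by simp
  have root2: "sqrt 2 *\<^sub>R x \<in> S" if "x \<in> S" for x
    using avg[OF that that] by (simp add: scaleR_2[symmetric] real_div_sqrt)
  have add: "x + y \<in> S" if "x \<in> S" "y \<in> S" for x y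
    using root2[OF avg[OF that]] by simp
  have half: "(1 / 2) *\<^sub>R x \<in> S" if "x \<in> S" for x
    using avg[OF avg[OF that zero] zero] by simp
  have dyadic: "(real m * (1 / 2) ^ n) *\<^sub>R x \<in> S" if "x \<in> S" for m n x
  proof -
    have pow: "(1 / 2) ^ n *\<^sub>R x \<in> S"
    proof (induction n)
      case (Suc n)
      from half[OF this] show ?case by simp
    qed (use that in simp)
    show ?thesis
    proof (induction m)
      case (Suc m)
      from add[OF pow this] show ?case by (simp add: algebra_simps)
    qed (use zero in simp)
  qed
  have nonneg: "c *\<^sub>R x \<in> S" if x: "x \<in> S" and c: "0 \<le> c" for c x
  proof -
    have "\<bar>real (nat \<lfloor>c * 2 ^ n\<rfloor>) * (1 / 2) ^ n - c\<bar> \<le> (1 / 2) ^ n" for n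
    proof -
      have "\<bar>real (nat \<lfloor>c * 2 ^ n\<rfloor>) - c * 2 ^ n\<bar> \<le> 1"
      proof -
        have "real (nat \<lfloor>c * 2 ^ n\<rfloor>) = real_of_int \<lfloor>c * 2 ^ n\<rfloor>" using c by simp
        with of_int_floor_le[of "c * 2 ^ n"] real_of_int_floor_gt_diff_one[of "c * 2 ^ n"]
        show ?thesis by (simp only: abs_le_iff) linarith
      qed
      then have "\<bar>real (nat \<lfloor>c * 2 ^ n\<rfloor>) - c * 2 ^ n\<bar> * (1 / 2) ^ n \<le> 1 * (1 / 2) ^ n"
        by (intro mult_right_mono) auto
      also have "\<bar>real (nat \<lfloor>c * 2 ^ n\<rfloor>) - c * 2 ^ n\<bar> * (1 / 2) ^ n =
          \<bar>(real (nat \<lfloor>c * 2 ^ n\<rfloor>) - c * 2 ^ n) * (1 / 2) ^ n\<bar>"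
        by (simp add: abs_mult)
      also have "(real (nat \<lfloor>c * 2 ^ n\<rfloor>) - c * 2 ^ n) * (1 / 2) ^ n =
          real (nat \<lfloor>c * 2 ^ n\<rfloor>) * (1 / 2) ^ n - c"
        by (simp add: field_simps)
      finally show ?thesis by simp
    qed
    then have "(\<lambda>n. real (nat \<lfloor>c * 2 ^ n\<rfloor>) * (1 / 2) ^ n - c) \<longlonglongrightarrow> 0"
      by (intro Lim_null_comparison[OF _ LIMSEQ_power_zero[of "1 / 2 :: real"]]) auto
    then have "(\<lambda>n. real (nat \<lfloor>c * 2 ^ n\<rfloor>) * (1 / 2) ^ n) \<longlonglongrightarrow> c"
      by (simp add: LIM_zero_iff)
    then have "(\<lambda>n. (real (nat \<lfloor>c * 2 ^ n\<rfloor>) * (1 / 2) ^ n) *\<^sub>R x) \<longlonglongrightarrow> c *\<^sub>R x"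
      by (intro tendsto_intros)
    then show ?thesis by (rule closed_sequentially[OF S(1) dyadic[OF x]])
  qed
  show ?thesis
  proof (rule subspaceI)
    fix c :: real and x assume x: "x \<in> S"
    show "c *\<^sub>R x \<in> S"
      using nonneg[OF x, of c] nonneg[OF neg[OF x], of "- c"] by (cases "0 \<le> c") auto
  qed (use zero add in auto)
qed

section \<open>The support of a centered Gaussian law\<close>

text \<open>
  Borel measurability of the composite is a hypothesis because the inner map is not required to be
  Borel measurable: for a pair of random elements of a nonseparable space it may fail to be.
\<close>

lemma strongly_measurable_continuous_image:
  fixes f :: "'a::topological_space \<Rightarrow> 'b::banach"
  assumes f: "continuous_on UNIV f" and D: "countable D" "AE \<omega> in M. V \<omega> \<in> closure D"
    and meas: "(\<lambda>\<omega>. f (V \<omega>)) \<in> borel_measurable M"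
  shows "strongly_measurable M (\<lambda>\<omega>. f (V \<omega>))"
  unfolding strongly_measurable_def
proof (intro conjI exI[of _ "f ` D"])
  have "f ` closure D \<subseteq> closure (f ` D)"
    by (rule image_closure_subset) (auto intro: continuous_on_subset[OF f] closure_subset[THEN subsetD])
  then show "AE \<omega> in M. f (V \<omega>) \<in> closure (f ` D)"
    using D(2) by (auto elim!: eventually_mono)
qed (use D(1) meas in auto)

text \<open>
  Centered Gaussian laws that are carried by the closure of a countable set; they are tight, hence
  Radon.
\<close>

locale radon_gaussian = prob_space \<mu> for \<mu> :: "'b::banach measure" +
  assumes sets_eq_borel [measurable_cong]: "sets \<mu> = sets borel"
    and separable: "strongly_measurable \<mu> (\<lambda>x. x)"
    and normal_marginals: "\<And>\<eta>::'b \<Rightarrow>\<^sub>L real. centered_normal (distr \<mu> borel \<eta>)"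
begin

lemma measurable_functional [measurable]: "blinfun_apply \<eta> \<in> borel_measurable borel"
  by (intro borel_measurable_continuous_onI continuous_intros)

lemma law_uminus: "distr \<mu> borel uminus = \<mu>"
proof -
  obtain D where D: "countable D" "AE x in \<mu>. x \<in> closure D"
    using separable by (auto simp: strongly_measurable_def)
  have um[measurable]: "(uminus :: 'b \<Rightarrow> 'b) \<in> borel_measurable borel"
    by (intro borel_measurable_continuous_onI continuous_intros)
  have "distr \<mu> borel (\<lambda>x. - x) = distr \<mu> borel (\<lambda>x. x)"
  proof (rule law_determined_by_marginals[OF prob_space_axioms prob_space_axioms _ separable])
    show "strongly_measurable \<mu> (\<lambda>x. - x)"
      by (rule strongly_measurable_continuous_image[OF _ D]) (auto intro!: continuous_intros)
    fix \<eta> :: "'b \<Rightarrow>\<^sub>L real"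
    have "distr \<mu> borel (\<lambda>x. \<eta> (- x)) = distr (distr \<mu> borel \<eta>) borel uminus"
      by (subst distr_distr) (simp_all add: o_def blinfun.minus_right)
    also have "\<dots> = distr \<mu> borel \<eta>"
      by (rule centered_normal_minus[OF normal_marginals]) (simp_all add: prob_space_distr)
    finally show "distr \<mu> borel (\<lambda>x. \<eta> (- x)) = distr \<mu> borel (\<lambda>x. \<eta> x)" .
  qed
  also have "\<dots> = \<mu>" by (rule distr_id2) (simp add: sets_eq_borel)
  finally show ?thesis .
qed

lemma support_uminus:
  assumes "x \<in> support \<mu>"
  shows "- x \<in> support \<mu>"
  unfolding support_def
proof (intro CollectI allI impI)
  fix r :: real assume r: "0 < r"
  have um[measurable]: "(uminus :: 'b \<Rightarrow> 'b) \<in> borel_measurable borel"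
    by (intro borel_measurable_continuous_onI continuous_intros)
  have "prob (ball (- x) r) = measure (distr \<mu> borel uminus) (ball (- x) r)"
    by (simp only: law_uminus)
  also have "\<dots> = prob (uminus -` ball (- x) r \<inter> space \<mu>)"
    by (rule measure_distr) auto
  also have "uminus -` ball (- x) r \<inter> space \<mu> = ball x r"
    using sets_eq_imp_space_eq[OF sets_eq_borel] dist_minus[of x] by (fastforce simp: dist_minus)
  finally show "0 < prob (ball (- x) r)" using assms r by (simp add: support_def)
qed

text \<open>
  A version of the identity whose values all lie in the closure of a countable set, so that sums of
  two independent copies of it are measurable.
\<close>

lemma separable_version:
  obtains c D where "c \<in> borel_measurable \<mu>" "countable D" "\<And>x. c x \<in> closure D" "AE x in \<mu>. c x = x"
proof -
  obtain D where D: "countable D" "AE x in \<mu>. x \<in> closure D"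
    using separable by (auto simp: strongly_measurable_def)
  have [measurable]: "closure D \<in> sets borel" by simp
  show thesis
  proof (rule that)
    show "(\<lambda>x. if x \<in> closure D then x else 0) \<in> borel_measurable \<mu>" by measurable
    show "countable (insert 0 D)" using D(1) by simp
    show "(if x \<in> closure D then x else 0) \<in> closure (insert 0 D)" for x
      using closure_mono[of D "insert 0 D"] closure_subset[of "insert 0 D"] by auto
    show "AE x in \<mu>. (if x \<in> closure D then x else 0) = x" using D(2) by (auto elim: eventually_mono)
  qed
qed

text \<open>
  The law of \<open>Z = (V + V') / \<surd>2\<close>, where \<open>V\<close> and \<open>V'\<close> are independent copies, is again \<open>\<mu>\<close>.
  If \<open>V\<close> is within \<open>r / 2\<close> of \<open>x\<close> and \<open>V'\<close> is within \<open>r / 2\<close> of \<open>y\<close>, two independent events of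
  positive probability, then \<open>Z\<close> is within \<open>r\<close> of \<open>(x + y) / \<surd>2\<close>.
\<close>

lemma support_normalized_sum:
  assumes x: "x \<in> support \<mu>" and y: "y \<in> support \<mu>"
  shows "(1 / sqrt 2) *\<^sub>R (x + y) \<in> support \<mu>"
proof -
  interpret P: pair_prob_space \<mu> \<mu> ..
  obtain c D where c[measurable]: "c \<in> borel_measurable \<mu>" and D: "countable D"
    and cD: "\<And>x. c x \<in> closure D" and cx: "AE x in \<mu>. c x = x"
    using separable_version by metis
  define Z where "Z z = (1 / sqrt 2) *\<^sub>R (c (fst z) + c (snd z))" for z
  have "(\<lambda>z. c (fst z) + c (snd z)) \<in> borel_measurable (\<mu> \<Otimes>\<^sub>M \<mu>)"
    by (rule borel_measurable_add_separable[OF D cD cD]) measurable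
  then have Z[measurable]: "Z \<in> borel_measurable (\<mu> \<Otimes>\<^sub>M \<mu>)"
    unfolding Z_def by (rule borel_measurable_continuous_on[rotated]) (intro continuous_intros)
  have strong: "strongly_measurable (\<mu> \<Otimes>\<^sub>M \<mu>) Z"
  proof -
    have "strongly_measurable (\<mu> \<Otimes>\<^sub>M \<mu>)
      (\<lambda>z. (\<lambda>(a, b). (1 / sqrt 2) *\<^sub>R (a + b)) (c (fst z), c (snd z)))"
    proof (rule strongly_measurable_continuous_image[where D = "D \<times> D"])
      show "continuous_on UNIV (\<lambda>(a, b). (1 / sqrt 2) *\<^sub>R (a + b :: 'b))"
        unfolding case_prod_unfold by (intro continuous_intros)
      show "countable (D \<times> D)" using D by simp
      show "AE z in \<mu> \<Otimes>\<^sub>M \<mu>. (c (fst z), c (snd z)) \<in> closure (D \<times> D)"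
        using cD by (simp add: closure_Times)
      show "(\<lambda>z. (\<lambda>(a, b). (1 / sqrt 2) *\<^sub>R (a + b)) (c (fst z), c (snd z))) \<in> borel_measurable (\<mu> \<Otimes>\<^sub>M \<mu>)"
        using Z by (simp add: Z_def[abs_def])
    qed
    then show ?thesis by (simp add: Z_def[abs_def])
  qed
  have "distr (\<mu> \<Otimes>\<^sub>M \<mu>) borel Z = distr \<mu> borel (\<lambda>x. x)"
  proof (rule law_determined_by_marginals[OF P.prob_space_axioms prob_space_axioms strong separable])
    fix \<eta> :: "'b \<Rightarrow>\<^sub>L real"
    let ?\<nu> = "distr \<mu> borel \<eta>"
    \<comment> \<open>The map \<open>c\<close> is inserted before products are formed, so that null sets matter on one factor only.\<close>
    have \<nu>: "?\<nu> = distr \<mu> borel (\<lambda>x. \<eta> (c x))"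
      by (rule distr_cong_AE) (use cx in \<open>auto elim: eventually_mono\<close>)
    have prob: "prob_space ?\<nu>" by (rule prob_space_distr) simp
    have "?\<nu> \<Otimes>\<^sub>M ?\<nu> = distr (\<mu> \<Otimes>\<^sub>M \<mu>) (borel \<Otimes>\<^sub>M borel) (\<lambda>(x, y). (\<eta> (c x), \<eta> (c y)))"
      unfolding \<nu>
    proof (rule pair_measure_distr)
      show "sigma_finite_measure (distr \<mu> borel (\<lambda>x. \<eta> (c x)))"
        using prob unfolding \<nu> by (rule prob_space_imp_sigma_finite)
    qed measurable
    then have "distr (?\<nu> \<Otimes>\<^sub>M ?\<nu>) borel (\<lambda>z. (fst z + snd z) / sqrt 2) =
        distr (\<mu> \<Otimes>\<^sub>M \<mu>) borel ((\<lambda>z. (fst z + snd z) / sqrt 2) \<circ> (\<lambda>(x, y). (\<eta> (c x), \<eta> (c y))))"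
      by (simp only:) (rule distr_distr; measurable)
    also have "(\<lambda>z. (fst z + snd z) / sqrt 2) \<circ> (\<lambda>(x, y). (\<eta> (c x), \<eta> (c y))) = (\<lambda>z. \<eta> (Z z))"
      by (auto simp: Z_def blinfun.scaleR_right blinfun.add_right)
    finally show "distr (\<mu> \<Otimes>\<^sub>M \<mu>) borel (\<lambda>z. \<eta> (Z z)) = distr \<mu> borel (\<lambda>x. \<eta> x)"
      using centered_normal_stable[OF normal_marginals prob] by simp
  qed
  also have "\<dots> = \<mu>" by (rule distr_id2) (simp add: sets_eq_borel)
  finally have law_Z: "distr (\<mu> \<Otimes>\<^sub>M \<mu>) borel Z = \<mu>" .
  have law_c: "distr \<mu> borel c = \<mu>"
  proof -
    have "distr \<mu> borel c = distr \<mu> borel (\<lambda>x. x)" by (rule distr_cong_AE) (use cx in auto)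
    also have "\<dots> = \<mu>" by (rule distr_id2) (simp add: sets_eq_borel)
    finally show ?thesis .
  qed
  show ?thesis unfolding support_def
  proof (intro CollectI allI impI)
    fix r :: real assume r: "0 < r"
    let ?m = "(1 / sqrt 2) *\<^sub>R (x + y)"
    define A where "A w = c -` ball w (r / 2) \<inter> space \<mu>" for w
    have A[measurable]: "A w \<in> sets \<mu>" for w unfolding A_def by measurable
    have pos: "0 < prob (A w)" if "w \<in> support \<mu>" for w
    proof -
      have "prob (A w) = measure (distr \<mu> borel c) (ball w (r / 2))"
        unfolding A_def by (rule measure_distr[symmetric]) auto
      with that r show ?thesis by (simp add: law_c support_def)
    qed
    have "A x \<times> A y \<subseteq> Z -` ball ?m r \<inter> space (\<mu> \<Otimes>\<^sub>M \<mu>)"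
    proof
      fix z assume z: "z \<in> A x \<times> A y"
      have "dist ?m (Z z) = (1 / sqrt 2) * dist (x + y) (c (fst z) + c (snd z))"
        by (simp add: Z_def dist_norm flip: scaleR_diff_right)
      also have "\<dots> \<le> 1 * dist (x + y) (c (fst z) + c (snd z))"
        by (intro mult_right_mono) auto
      also have "\<dots> \<le> dist x (c (fst z)) + dist y (c (snd z))" using dist_triangle_add by simp
      also have "\<dots> < r" using z by (auto simp: A_def)
      finally show "z \<in> Z -` ball ?m r \<inter> space (\<mu> \<Otimes>\<^sub>M \<mu>)"
        using z by (auto simp: A_def space_pair_measure)
    qed
    then have "measure (\<mu> \<Otimes>\<^sub>M \<mu>) (A x \<times> A y) \<le> measure (\<mu> \<Otimes>\<^sub>M \<mu>) (Z -` ball ?m r \<inter> space (\<mu> \<Otimes>\<^sub>M \<mu>))"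
      by (intro P.finite_measure_mono) auto
    also have "\<dots> = measure (distr (\<mu> \<Otimes>\<^sub>M \<mu>) borel Z) (ball ?m r)"
      by (rule measure_distr[symmetric]) auto
    also have "\<dots> = prob (ball ?m r)" by (simp only: law_Z)
    also have "measure (\<mu> \<Otimes>\<^sub>M \<mu>) (A x \<times> A y) = prob (A x) * prob (A y)"
      by (simp add: measure_def emeasure_pair_measure_Times enn2real_mult)
    finally show "0 < prob (ball ?m r)"
      using mult_pos_pos[OF pos[OF x] pos[OF y]] by simp
  qed
qed

theorem subspace_support: "subspace (support \<mu>)"
proof (rule subspace_if_normalized_sums)
  show "closed (support \<mu>)" by (rule closed_support[OF prob_space_axioms sets_eq_borel])
  show "support \<mu> \<noteq> {}"
    using AE_support[OF prob_space_axioms sets_eq_borel separable] by (auto simp: AE_False)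
qed (fact support_uminus support_normalized_sum)+

theorem full_support:
  assumes "\<And>\<eta>::'b \<Rightarrow>\<^sub>L real. (AE x in \<mu>. blinfun_apply \<eta> x = 0) \<Longrightarrow> \<eta> = 0"
  shows "support \<mu> = UNIV"
proof (rule ccontr)
  assume "support \<mu> \<noteq> UNIV"
  then obtain x where "x \<notin> support \<mu>" by auto
  then obtain \<eta> :: "'b \<Rightarrow>\<^sub>L real" where \<eta>: "\<And>s. s \<in> support \<mu> \<Longrightarrow> \<eta> s = 0" "\<eta> x \<noteq> 0"
    using separate_point_from_closed_subspace[OF subspace_support closed_support[OF prob_space_axioms sets_eq_borel]]
    by metis
  have "AE z in \<mu>. \<eta> z = 0"
    by (rule eventually_mono[OF AE_support[OF prob_space_axioms sets_eq_borel separable] \<eta>(1)])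
  from assms[OF this] \<eta>(2) show False by simp
qed

end

section \<open>Characteristic Gaussian fields\<close>

lemma radon_gaussian_law:
  fixes M :: "'w measure" and emb :: "'b::banach \<Rightarrow> 's" and U :: "'w \<Rightarrow> 's"
  assumes M: "prob_space M" and U: "gaussian_field_in M emb U" and mean: "zero_mean M emb U"
  shows "radon_gaussian (distr M borel (path_in emb U))"
proof -
  let ?V = "path_in emb U"
  have V[measurable]: "?V \<in> borel_measurable M" and sm: "strongly_measurable M ?V"
    and gauss: "\<And>\<eta>. gaussian_rv M (pairing emb U \<eta>)"
    using U by (auto simp: gaussian_field_in_def strongly_measurable_def)
  interpret prob_space M by fact
  interpret law: prob_space "distr M borel ?V" by (rule prob_space_distr) fact
  show ?thesis
  proof
    obtain D where "countable D" "AE \<omega> in M. ?V \<omega> \<in> closure D"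
      using sm by (auto simp: strongly_measurable_def)
    then show "strongly_measurable (distr M borel ?V) (\<lambda>x. x)"
      unfolding strongly_measurable_def by (auto simp: AE_distr_iff)
    fix \<eta> :: "'b \<Rightarrow>\<^sub>L real"
    have "blinfun_apply \<eta> \<in> borel_measurable borel"
      by (intro borel_measurable_continuous_onI continuous_intros)
    then have "distr (distr M borel ?V) borel \<eta> = distr M borel (pairing emb U \<eta>)"
      by (subst distr_distr) (auto simp: o_def pairing_def[abs_def])
    with centered_normal_law[OF M gauss] mean show "centered_normal (distr (distr M borel ?V) borel \<eta>)"
      by (simp add: zero_mean_def)
  qed simp
qed

lemma centered_normal_square_integrable:
  assumes \<nu>: "centered_normal \<nu>"
  shows "integrable \<nu> (\<lambda>t. t\<^sup>2)"
proof -
  from \<nu> consider "\<nu> = return borel 0"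
    | \<sigma> where "0 < \<sigma>" "distributed \<nu> lborel (\<lambda>t. t) (normal_density 0 \<sigma>)"
    by (auto simp: centered_normal_def)
  then show ?thesis
  proof cases
    case 1
    have "integrable (distr (return borel 0) borel (\<lambda>_. 0::real)) (\<lambda>t. t\<^sup>2)"
      by (subst integrable_distr_eq) auto
    with 1 show ?thesis by (simp add: distr_return)
  next
    case 2
    have "integrable lborel (\<lambda>t. normal_density 0 \<sigma> t * t\<^sup>2)"
      using integrable_normal_moment[OF 2(1), of 0 2] by simp
    then show ?thesis
      using distributed_integrable[OF 2(2), of "\<lambda>t. t\<^sup>2"] by simp
  qed
qed

text \<open>
  Square integrability matters here: the Bochner integral of a nonintegrable function is \<open>0\<close>, so
  without it a vanishing second moment would say nothing.
\<close>

lemma D_sq_eq_0_iff: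
  assumes M: "prob_space M" and U: "gaussian_field_in M emb U" and mean: "zero_mean M emb U"
  shows "D_sq M emb U \<eta> = 0 \<longleftrightarrow> (AE \<omega> in M. pairing emb U \<eta> \<omega> = 0)"
proof -
  have X: "gaussian_rv M (pairing emb U \<eta>)" using U by (simp add: gaussian_field_in_def)
  then have [measurable]: "pairing emb U \<eta> \<in> borel_measurable M" by (simp add: gaussian_rv_def)
  have "integrable (distr M borel (pairing emb U \<eta>)) (\<lambda>t. t\<^sup>2)"
    using mean by (intro centered_normal_square_integrable centered_normal_law[OF M X]) (simp add: zero_mean_def)
  then have "integrable M (\<lambda>\<omega>. (pairing emb U \<eta> \<omega>)\<^sup>2)" by (simp add: integrable_distr_eq)
  then show ?thesis
    unfolding D_sq_def by (subst integral_nonneg_eq_0_iff_AE) auto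
qed

lemma field_support_eq_support:
  assumes [measurable]: "path_in emb U \<in> borel_measurable M"
  shows "field_support M emb U = support (distr M borel (path_in emb U))"
proof -
  have "ball_prob M emb U f r = measure (distr M borel (path_in emb U)) (ball f r)" for f r
  proof -
    have "{\<omega> \<in> space M. norm (path_in emb U \<omega> - f) < r} = path_in emb U -` ball f r \<inter> space M"
      by (auto simp: dist_norm norm_minus_commute)
    then show ?thesis by (simp add: ball_prob_def measure_distr)
  qed
  then show ?thesis by (simp add: field_support_def support_def)
qed

lemma full_support_AE_zero:
  fixes \<mu> :: "'b::banach measure" and \<eta> :: "'b \<Rightarrow>\<^sub>L real"
  assumes "prob_space \<mu>" and sets[measurable_cong]: "sets \<mu> = sets borel"
    and supp: "support \<mu> = UNIV" and zero: "AE x in \<mu>. \<eta> x = 0"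
  shows "\<eta> = 0"
proof (rule ccontr)
  interpret prob_space \<mu> by fact
  assume "\<eta> \<noteq> 0"
  then obtain x where x: "\<eta> x \<noteq> 0" by (metis blinfun_eqI zero_blinfun.rep_eq)
  have "open {z. \<eta> z \<noteq> 0}" by (intro open_Collect_neq continuous_intros)
  with x obtain r where r: "0 < r" "ball x r \<subseteq> {z. \<eta> z \<noteq> 0}" by (metis mem_Collect_eq openE)
  have "AE z in \<mu>. z \<notin> ball x r" using zero r(2) by (auto elim!: eventually_mono)
  then have "prob (ball x r) = 0" by (subst prob_eq_0) auto
  moreover have "x \<in> support \<mu>" using supp by simp
  ultimately show False using r(1) by (force simp: support_def)
qed

theorem corollary6p2:
  fixes M :: "'w measure" and emb :: "'b::banach \<Rightarrow> 's" and U :: "'w \<Rightarrow> 's"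
  assumes "prob_space M"
    and "inj emb"
    and "gaussian_field_in M emb U"
    and "zero_mean M emb U"
  shows "(characteristic M emb U \<longleftrightarrow> field_support M emb U = UNIV) \<and>
         (characteristic M emb U \<longrightarrow> (\<forall>f. \<forall>\<epsilon>>0. ball_prob M emb U f \<epsilon> > 0))"
proof -
  let ?\<mu> = "distr M borel (path_in emb U)"
  have V[measurable]: "path_in emb U \<in> borel_measurable M"
    using assms(3) by (simp add: gaussian_field_in_def strongly_measurable_def)
  interpret law: radon_gaussian ?\<mu> by (rule radon_gaussian_law[OF assms(1,3,4)])
  have AE_law: "(AE x in ?\<mu>. \<eta> x = 0) \<longleftrightarrow> D_sq M emb U \<eta> = 0" for \<eta> :: "'b \<Rightarrow>\<^sub>L real"
    unfolding D_sq_eq_0_iff[OF assms(1,3,4)] pairing_def by (subst AE_distr_iff) simp_all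
  have iff: "characteristic M emb U \<longleftrightarrow> field_support M emb U = UNIV"
    unfolding field_support_eq_support[OF V] characteristic_def AE_law[symmetric]
    using law.full_support full_support_AE_zero[OF law.prob_space_axioms law.sets_eq_borel] by blast
  then show ?thesis by (auto simp: field_support_def)
qed

end
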